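(* Let $\mathcal{X}$ be a countable set, let $x_{1:n} \in \mathcal{X}^n$ and let $x \in \mathcal{X}$. Let $\xi$ be a mixture model over a class $\mathcal{M}$ of learning-positive density models on $\mathcal{X}$, with $\xi_n(x) > 0$. Let $\mathrm{IG}_n(x)$ be the information gain of $\xi$, let $\mathrm{PG}_n(x)$ be the prediction gain of $\xi$, and let $\hat N_n(x)$ be the pseudo-count derived from $\xi$, where the system defining the pseudo-count is assumed consistent. Then $$\mathrm{IG}_n(x) \le \mathrm{PG}_n(x) \le \hat N_n(x)^{-1} \qquad \text{and} \qquad \mathrm{PG}_n(x) \le \hat N_n(x)^{-1/2}.$$
   Context: A model over $\mathcal{X}$ is a map $\rho$ from the set $\mathcal{X}^*$ of finite sequences to probability distributions on $\mathcal{X}$; write $\rho_n(x) := \rho(x; x_{1:n})$ for the probability assigned to $x$ after the sequence $x_{1:n}$, and $\rho'_n(x) := \rho(x; x_{1:n}x)$ (the recoding probability), where $x_{1:n}x$ is the concatenation of $x_{1:n}$ with $x$. A density model is a model in this sense that assumes states are independently (not necessarily identically) distributed. A density model $\rho$ is learning-positive if $\rho'_n(x) \ge \rho_n(x)$ for all $n$, all $x_{1:n} \in \mathcal{X}^n$ and all $x \in \mathcal{X}$. Mixture model: given a prior distribution $w_0$ over $\mathcal{M}$ (a density with respect to a reference measure $\mathrm{d}\rho$ on $\mathcal{M}$), put $$\xi_n(x) := \xi(x; x_{1:n}) := \int_{\rho\in\mathcal{M}} w_n(\rho)\, \rho(x; x_{1:n})\, \mathrm{d}\rho,$$ where the posterior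 weights are defined recursively by $w_{n+1}(\rho) := w_n(\rho, x_{n+1})$ with $w_n(\rho, x) := w_n(\rho)\rho(x; x_{1:n})/\xi_n(x)$. As for any model, $\xi'_n(x) := \xi(x; x_{1:n}x)$. Information gain: $\mathrm{IG}_n(x) := \mathrm{KL}\big(w_n(\cdot, x)\,\|\, w_n\big)$, the Kullback-Leibler divergence $\int w_n(\rho,x)\log\frac{w_n(\rho,x)}{w_n(\rho)}\,\mathrm{d}\rho$. Prediction gain of $\xi$: $\mathrm{PG}_n(x) := \log \xi'_n(x) - \log \xi_n(x)$. Pseudo-count derived from $\xi$: the quantity $\hat N_n(x)$ which, with a second unknown $\hat n$, solves $\xi_n(x) = \hat N_n(x)/\hat n$ and $\xi'_n(x) = (\hat N_n(x)+1)/(\hat n+1)$, that is, $$\hat N_n(x) = \frac{\xi_n(x)(1-\xi'_n(x))}{\xi'_n(x)-\xi_n(x)},$$ with $\hat N_n(x) = \infty$ (so $\hat N_n(x)^{-1} = \hat N_n(x)^{-1/2} = 0$) when $\xi'_n(x) = \xi_n(x)$. The system is consistent when it is not the case that $\xi_n(x) < \xi'_n(x) = 1$. *)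

theory Defs
  imports "HOL-Probability.Probability"
begin

text \<open>
  A model maps a finite history \<open>x\<^sub>1, \<dots>, x\<^sub>n\<close>, listed in temporal order, to a distribution on the
  state space. The state space is the type \<open>'x\<close>, of class \<open>countable\<close> where it matters.

  A density model is taken to be a model in this sense. That it assumes states to be independently,
  not necessarily identically, distributed is read as describing what the distribution
  \<open>\<rho> s\<close> is meant for (a density on single states, adapted along the history only
  through learning), not as a constraint on the map \<open>\<rho>\<close>: were \<open>\<rho> s\<close> required to depend on the
  length of \<open>s\<close> alone, learning-positivity would make \<open>\<rho>\<close> constant.
\<close>

type_synonym 'x model = "'x list \<Rightarrow> 'x pmf"

definition learning_positive :: "'x model \<Rightarrow> bool" where
  "learning_positive \<rho> \<longleftrightarrow> (\<forall>s x. pmf (\<rho> (s @ [x])) x \<ge> pmf (\<rho> s) x)"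


subsection \<open>Mixture models\<close>

text \<open>
  \<open>R\<close> is the reference measure; its space is the class of models. Prior and posterior weights are
  densities with respect to \<open>R\<close>.
\<close>

definition prior_density :: "'x model measure \<Rightarrow> ('x model \<Rightarrow> real) \<Rightarrow> bool" where
  "prior_density R w \<longleftrightarrow>
     w \<in> borel_measurable R \<and> (\<forall>\<rho>\<in>space R. 0 \<le> w \<rho>) \<and> integrable R w \<and> (\<integral>\<rho>. w \<rho> \<partial>R) = 1"

definition average ::
  "'x model measure \<Rightarrow> ('x model \<Rightarrow> real) \<Rightarrow> 'x list \<Rightarrow> 'x \<Rightarrow> real" where
  "average R w s x = (\<integral>\<rho>. w \<rho> * pmf (\<rho> s) x \<partial>R)"

definition update ::
  "'x model measure \<Rightarrow> ('x model \<Rightarrow> real) \<Rightarrow> 'x list \<Rightarrow> 'x \<Rightarrow> 'x model \<Rightarrow> real" where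
  "update R w s x \<rho> = w \<rho> * pmf (\<rho> s) x / average R w s x"

text \<open>The equations one wants are \<open>posterior_Nil\<close> and \<open>posterior_snoc\<close> below.\<close>

fun posterior ::
  "'x model measure \<Rightarrow> ('x model \<Rightarrow> real) \<Rightarrow> 'x list \<Rightarrow> 'x model \<Rightarrow> real" where
  "posterior R w\<^sub>0 s =
     (if s = [] then w\<^sub>0 else update R (posterior R w\<^sub>0 (butlast s)) (butlast s) (last s))"

declare posterior.simps [simp del]

lemma posterior_Nil [simp]: "posterior R w\<^sub>0 [] = w\<^sub>0"
  by (subst posterior.simps) simp

lemma posterior_snoc [simp]:
  "posterior R w\<^sub>0 (s @ [x]) = update R (posterior R w\<^sub>0 s) s x"
  by (subst posterior.simps) simp

text \<open>
  \<open>mixture R w\<^sub>0 s\<close> is real-valued rather than a \<open>pmf\<close> because the posterior weights, and with them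
  the mixture, are undefined (here: 0) after a history of mixture probability 0. Hence
  \<open>mixture R w\<^sub>0 s x > 0\<close> forces every step of \<open>s\<close> to have had positive mixture probability.
\<close>

definition mixture ::
  "'x model measure \<Rightarrow> ('x model \<Rightarrow> real) \<Rightarrow> 'x list \<Rightarrow> 'x \<Rightarrow> real" where
  "mixture R w\<^sub>0 s x = average R (posterior R w\<^sub>0 s) s x"


subsection \<open>Information gain, prediction gain, pseudo-count\<close>

text \<open>
  In the library, \<open>KL_divergence b P Q\<close> is the divergence of \<open>Q\<close> from \<open>P\<close>, that is
  \<open>KL(Q \<parallel> P)\<close>; base \<open>exp 1\<close> is the natural logarithm. The integral formula is
  \<open>information_gain_eq\<close> below.
\<close>

definition information_gain ::
  "'x model measure \<Rightarrow> ('x model \<Rightarrow> real) \<Rightarrow> 'x list \<Rightarrow> 'x \<Rightarrow> real" where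
  "information_gain R w\<^sub>0 s x =
     KL_divergence (exp 1) (density R (posterior R w\<^sub>0 s)) (density R (posterior R w\<^sub>0 (s @ [x])))"

text \<open>In the following, \<open>\<xi> s x\<close> is the probability of \<open>x\<close> after \<open>s\<close>.\<close>

definition recoding :: "('x list \<Rightarrow> 'x \<Rightarrow> real) \<Rightarrow> 'x list \<Rightarrow> 'x \<Rightarrow> real" where
  "recoding \<xi> s x = \<xi> (s @ [x]) x"

definition prediction_gain :: "('x list \<Rightarrow> 'x \<Rightarrow> real) \<Rightarrow> 'x list \<Rightarrow> 'x \<Rightarrow> real" where
  "prediction_gain \<xi> s x = ln (recoding \<xi> s x) - ln (\<xi> s x)"

definition pseudo_count :: "('x list \<Rightarrow> 'x \<Rightarrow> real) \<Rightarrow> 'x list \<Rightarrow> 'x \<Rightarrow> ereal" where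
  "pseudo_count \<xi> s x =
     (if recoding \<xi> s x = \<xi> s x then \<infinity>
      else ereal (\<xi> s x * (1 - recoding \<xi> s x) / (recoding \<xi> s x - \<xi> s x)))"

definition consistent :: "('x list \<Rightarrow> 'x \<Rightarrow> real) \<Rightarrow> 'x list \<Rightarrow> 'x \<Rightarrow> bool" where
  "consistent \<xi> s x \<longleftrightarrow> \<not> (\<xi> s x < recoding \<xi> s x \<and> recoding \<xi> s x = 1)"

definition ereal_sqrt :: "ereal \<Rightarrow> ereal" where
  "ereal_sqrt a = (case a of ereal r \<Rightarrow> ereal (sqrt r) | PInfty \<Rightarrow> \<infinity> | MInfty \<Rightarrow> -\<infinity>)"


subsection \<open>Agreement with the usual formulas\<close>

lemma pseudo_count_iff_system:
  assumes "0 < \<xi> s x" "\<xi> s x < recoding \<xi> s x" "recoding \<xi> s x < 1"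
  shows "pseudo_count \<xi> s x = ereal N \<longleftrightarrow>
    (\<exists>n. n \<noteq> 0 \<and> n + 1 \<noteq> 0 \<and> \<xi> s x = N / n \<and> recoding \<xi> s x = (N + 1) / (n + 1))"
proof -
  define p q where "p = \<xi> s x" and "q = recoding \<xi> s x"
  have pq: "0 < p" "p < q" "q < 1" using assms by (auto simp: p_def q_def)
  have "p * (1 - q) / (q - p) = N \<longleftrightarrow>
        (\<exists>n. n \<noteq> 0 \<and> n + 1 \<noteq> 0 \<and> p = N / n \<and> q = (N + 1) / (n + 1))" (is "?L \<longleftrightarrow> ?R")
  proof
    assume L: ?L
    have "N > 0" unfolding L[symmetric] using pq by simp
    have Np: "N / p = (1 - q) / (q - p)" unfolding L[symmetric] using pq by simp
    have n1: "N / p + 1 = (1 - p) / (q - p)" unfolding Np using pq by (simp add: field_simps)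
    have N1: "N + 1 = q * (1 - p) / (q - p)"
      unfolding L[symmetric] using pq by (simp add: field_simps)
    have "q = (N + 1) / (N / p + 1)" unfolding n1 N1 using pq by simp
    moreover have "N / p > 0" using \<open>N > 0\<close> pq by simp
    ultimately show ?R using pq \<open>N > 0\<close> by (intro exI[of _ "N / p"]) auto
  next
    assume ?R
    then obtain n where n: "n \<noteq> 0" "n + 1 \<noteq> 0" "p = N / n" "q = (N + 1) / (n + 1)" by blast
    have "N = p * n" "q * (n + 1) = N + 1" using n by auto
    then have "n * (q - p) = 1 - q" by (simp add: algebra_simps)
    then have "p * (1 - q) = N * (q - p)" using \<open>N = p * n\<close> by (metis mult.assoc)
    then show ?L using pq by (simp add: field_simps)
  qed
  then show ?thesis using pq by (simp add: pseudo_count_def p_def q_def)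
qed

lemma posterior_props:
  assumes w: "prior_density R w\<^sub>0"
    and meas: "\<And>s x. (\<lambda>\<rho>. pmf (\<rho> s) x) \<in> borel_measurable R"
  shows "posterior R w\<^sub>0 s \<in> borel_measurable R \<and> (\<forall>\<rho>\<in>space R. 0 \<le> posterior R w\<^sub>0 s \<rho>) \<and>
    integrable R (posterior R w\<^sub>0 s)"
proof (induction s rule: rev_induct)
  case Nil
  then show ?case using w by (simp add: prior_density_def)
next
  case (snoc x s)
  let ?w = "posterior R w\<^sub>0 s"
  have [measurable]: "?w \<in> borel_measurable R" "(\<lambda>\<rho>. pmf (\<rho> s) x) \<in> borel_measurable R"
    using snoc meas by auto
  have nn: "0 \<le> average R ?w s x"
    unfolding average_def using snoc by (intro integral_nonneg_AE) auto
  have "integrable R (\<lambda>\<rho>. ?w \<rho> * pmf (\<rho> s) x)"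
    by (rule Bochner_Integration.integrable_bound[of R ?w])
      (use snoc in \<open>auto simp: abs_mult pmf_le_1 mult_left_le\<close>)
  then show ?case
    using snoc nn by (auto simp: update_def[abs_def])
qed

lemma information_gain_eq:
  fixes R :: "'x model measure"
  assumes w: "prior_density R w\<^sub>0"
    and meas: "\<And>s x. (\<lambda>\<rho>. pmf (\<rho> s) x) \<in> borel_measurable R"
  shows "information_gain R w\<^sub>0 s x =
    (\<integral>\<rho>. posterior R w\<^sub>0 (s @ [x]) \<rho> *
         ln (posterior R w\<^sub>0 (s @ [x]) \<rho> / posterior R w\<^sub>0 s \<rho>) \<partial>R)"
proof -
  let ?w = "posterior R w\<^sub>0 s" and ?c = "mixture R w\<^sub>0 s x"
  let ?r = "\<lambda>\<rho>. pmf (\<rho> s) x / ?c"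
  note P = posterior_props[OF w meas, of s]
  have [measurable]: "?w \<in> borel_measurable R" "(\<lambda>\<rho>. pmf (\<rho> s) x) \<in> borel_measurable R"
    using P meas by auto
  have c: "?c \<ge> 0"
    unfolding mixture_def average_def using P by (intro integral_nonneg_AE) auto
  have "emeasure (density R ?w) (space R) < \<infinity>"
    using P by (subst emeasure_density) (auto simp: integrable_iff_bounded
      cong: nn_integral_cong)
  then interpret W: finite_measure "density R ?w"
    by (intro finite_measureI) auto
  have post: "posterior R w\<^sub>0 (s @ [x]) \<rho> = ?w \<rho> * ?r \<rho>" for \<rho>
    by (simp add: update_def mixture_def)
  have eq: "density R (posterior R w\<^sub>0 (s @ [x])) = density (density R ?w) ?r"
  proof (subst density_density_eq)
    have "ennreal (posterior R w\<^sub>0 (s @ [x]) \<rho>) = ennreal (?w \<rho>) * ennreal (?r \<rho>)"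
      if "\<rho> \<in> space R" for \<rho>
      unfolding post using P c that by (intro ennreal_mult) auto
    then show "density R (posterior R w\<^sub>0 (s @ [x])) =
        density R (\<lambda>\<rho>. ennreal (?w \<rho>) * ennreal (?r \<rho>))"
      using posterior_props[OF w meas, of "s @ [x]"]
      by (intro density_cong AE_I2) (auto simp del: posterior_snoc)
  qed auto
  have "information_gain R w\<^sub>0 s x = (\<integral>\<rho>. ?r \<rho> * log (exp 1) (?r \<rho>) \<partial>density R ?w)"
    unfolding information_gain_def eq using c by (intro W.KL_density) auto
  also have "\<dots> = (\<integral>\<rho>. ?w \<rho> * (?r \<rho> * log (exp 1) (?r \<rho>)) \<partial>R)"
    using P by (subst integral_real_density) auto
  also have "\<dots> = (\<integral>\<rho>. posterior R w\<^sub>0 (s @ [x]) \<rho> *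
         ln (posterior R w\<^sub>0 (s @ [x]) \<rho> / ?w \<rho>) \<partial>R)"
    by (intro Bochner_Integration.integral_cong refl) (simp add: post log_def del: posterior_snoc)
  finally show ?thesis .
qed

end

theory Submission
  imports Defs
begin

text \<open>
  Write \<open>w\<close> for the posterior weights, \<open>r\<close> and \<open>r'\<close> for the probability and the recoding probability
  of \<open>x\<close> under the individual models, \<open>p = \<integral> w r\<close> for the mixture probability, \<open>v = w r / p\<close> for
  the updated weights and \<open>q = \<integral> v r'\<close> for the recoding probability of the mixture. Then
  \<open>v / w = r / p \<le> r' / p\<close> by learning-positivity, so Jensen's inequality for \<open>ln\<close> bounds the
  information gain \<open>\<integral> v ln (r / p)\<close> by \<open>ln (q / p)\<close>, the prediction gain. It also follows that
  \<open>q \<ge> \<integral> w r\<^sup>2 / p \<ge> p\<close>, and with \<open>t = q / p - 1\<close> the pseudo-count satisfies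
  \<open>1 / N = t / (1 - q) \<ge> t\<close>; the other two bounds are \<open>ln (1 + t) \<le> t\<close> and \<open>ln (1 + t) \<le> \<surd>t\<close>.
\<close>

text \<open>With \<open>u = sqrt t\<close> this is \<open>1 + u^2 \<le> exp u\<close>. The quadratic
  Taylor bound for \<open>exp u\<close> is too weak once \<open>u > 2\<close>, but the square of the
  one for \<open>exp (u / 2)\<close> suffices.\<close>

lemma ln_one_plus_le_sqrt:
  fixes t :: real
  assumes "0 \<le> t"
  shows "ln (1 + t) \<le> sqrt t"
proof -
  define u where "u = sqrt t"
  have u: "0 \<le> u" "u\<^sup>2 = t" using assms by (auto simp: u_def)
  \<comment> \<open>This is the excess of that square over \<open>1 + u^2\<close>, with
    \<open>u^2 - 4 * u + 8\<close> written as a completed square.\<close>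
  have "0 \<le> u * ((u - 2)\<^sup>2 + 4) / 8 + (u\<^sup>2)\<^sup>2 / 64" using u(1) by simp
  also have "\<dots> = (1 + u / 2 + (u / 2)\<^sup>2 / 2)\<^sup>2 - (1 + u\<^sup>2)"
    by (simp add: power2_eq_square field_simps)
  finally have "1 + t \<le> (1 + u / 2 + (u / 2)\<^sup>2 / 2)\<^sup>2" using u by simp
  also have "\<dots> \<le> (exp (u / 2))\<^sup>2"
    using exp_lower_Taylor_quadratic[of "u / 2"] u(1) by (intro power_mono) auto
  also have "\<dots> = exp u" by (simp flip: exp_of_nat_mult)
  finally have "ln (1 + t) \<le> ln (exp u)" using assms by (subst ln_le_cancel_iff) auto
  then show ?thesis by (simp add: u_def)
qed

lemma integrable_mult_bounded:
  fixes w f :: "'a \<Rightarrow> real"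
  assumes "integrable M w" "f \<in> borel_measurable M" "\<And>a. a \<in> space M \<Longrightarrow> \<bar>f a\<bar> \<le> 1"
  shows "integrable M (\<lambda>a. w a * f a)"
  by (rule Bochner_Integration.integrable_bound[OF assms(1)])
    (use assms in \<open>auto simp: abs_mult mult_left_le\<close>)

text \<open>The variance of \<open>r\<close> under the weights \<open>w\<close> is
  nonnegative.\<close>

lemma square_mean_le_mean_square:
  fixes w r :: "'a \<Rightarrow> real"
  assumes w: "integrable M w" "\<And>a. a \<in> space M \<Longrightarrow> 0 \<le> w a" "(\<integral>a. w a \<partial>M) = 1"
    and r: "r \<in> borel_measurable M" "\<And>a. a \<in> space M \<Longrightarrow> \<bar>r a\<bar> \<le> 1"
  shows "(\<integral>a. w a * r a \<partial>M)\<^sup>2 \<le> (\<integral>a. w a * (r a)\<^sup>2 \<partial>M)"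
proof -
  let ?p = "\<integral>a. w a * r a \<partial>M"
  have ir: "integrable M (\<lambda>a. w a * r a)"
    using w r by (intro integrable_mult_bounded) auto
  have ir2: "integrable M (\<lambda>a. w a * (r a)\<^sup>2)"
    using w r by (intro integrable_mult_bounded) (auto simp: abs_square_le_1)
  have "0 \<le> (\<integral>a. w a * (r a - ?p)\<^sup>2 \<partial>M)"
    using w by (intro integral_nonneg_AE AE_I2) auto
  also have "\<dots> = (\<integral>a. w a * (r a)\<^sup>2 - 2 * ?p * (w a * r a) + ?p\<^sup>2 * w a \<partial>M)"
    by (intro Bochner_Integration.integral_cong refl) (simp add: power2_eq_square algebra_simps)
  also have "\<dots> = (\<integral>a. w a * (r a)\<^sup>2 \<partial>M) - ?p\<^sup>2"
    using w ir ir2 by (simp add: power2_eq_square)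
  finally show ?thesis by simp
qed

text \<open>Learning-positivity passes to the mixture: replacing \<open>r'\<close> by the smaller
  \<open>r\<close> leaves the second moment of \<open>r\<close> divided by its mean.\<close>

lemma recoding_average_ge:
  fixes w r r' :: "'a \<Rightarrow> real"
  assumes w: "integrable M w" "\<And>a. a \<in> space M \<Longrightarrow> 0 \<le> w a" "(\<integral>a. w a \<partial>M) = 1"
    and meas: "r \<in> borel_measurable M" "r' \<in> borel_measurable M"
    and r: "\<And>a. a \<in> space M \<Longrightarrow> 0 \<le> r a \<and> r a \<le> r' a \<and> r' a \<le> 1"
    and p: "p = (\<integral>a. w a * r a \<partial>M)" "0 < p"
  shows "p \<le> (\<integral>a. w a * r a / p * r' a \<partial>M)"
proof -
  have b: "\<bar>r a\<bar> \<le> 1" "\<bar>r' a\<bar> \<le> 1" if "a \<in> space M" for a using r[OF that] by auto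
  have ir: "integrable M (\<lambda>a. w a * r a)"
    using w meas b by (intro integrable_mult_bounded)
  have "p = p\<^sup>2 / p" using p(2) by (simp add: power2_eq_square)
  also have "\<dots> \<le> (\<integral>a. w a * (r a)\<^sup>2 \<partial>M) / p"
    unfolding p(1) using w meas b p by (intro divide_right_mono square_mean_le_mean_square) auto
  also have "\<dots> = (\<integral>a. w a * r a / p * r a \<partial>M)"
    by (simp add: power2_eq_square mult.assoc)
  also have "\<dots> \<le> (\<integral>a. w a * r a / p * r' a \<partial>M)"
    using w meas r b p(2) ir
    by (intro integral_mono integrable_mult_bounded mult_left_mono) auto
  finally show ?thesis .
qed

text \<open>Jensen's inequality through the tangent of \<open>ln\<close> at \<open>q\<close>:
  \<open>ln (r' / p) \<le> ln (q / p) + r' / q - 1\<close>, whose last two terms cancel when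
  integrated against \<open>v\<close>.\<close>

lemma relative_entropy_le:
  fixes v r r' :: "'a \<Rightarrow> real"
  assumes v: "integrable M v" "\<And>a. a \<in> space M \<Longrightarrow> 0 \<le> v a" "(\<integral>a. v a \<partial>M) = 1"
    and meas: "r' \<in> borel_measurable M"
    and r: "\<And>a. a \<in> space M \<Longrightarrow> 0 < v a \<Longrightarrow> 0 < r a"
      "\<And>a. a \<in> space M \<Longrightarrow> r a \<le> r' a \<and> 0 \<le> r' a \<and> r' a \<le> 1"
    and p: "0 < p" and q: "q = (\<integral>a. v a * r' a \<partial>M)" "p \<le> q"
  shows "(\<integral>a. v a * ln (r a / p) \<partial>M) \<le> ln (q / p)"
proof (cases "integrable M (\<lambda>a. v a * ln (r a / p))")
  case True
  have ir': "integrable M (\<lambda>a. v a * r' a)"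
    using v meas r by (intro integrable_mult_bounded) auto
  have "(\<integral>a. v a * ln (r a / p) \<partial>M) \<le> (\<integral>a. (ln (q / p) - 1) * v a + v a * r' a / q \<partial>M)"
  proof (intro integral_mono True)
    show "integrable M (\<lambda>a. (ln (q / p) - 1) * v a + v a * r' a / q)"
      using v ir' by simp
    fix a assume a: "a \<in> space M"
    show "v a * ln (r a / p) \<le> (ln (q / p) - 1) * v a + v a * r' a / q"
    proof (cases "v a = 0")
      case False
      then have va: "0 < v a" using v(2)[OF a] by simp
      have ra: "0 < r a" "r a \<le> r' a" using r a va by auto
      have "ln (r a / p) \<le> ln (r' a / p)" using ra p by (simp add: divide_right_mono)
      also have "\<dots> = ln (q / p) + ln (r' a / q)" using ra p q(2) by (simp add: ln_div)
      also have "\<dots> \<le> ln (q / p) + (r' a / q - 1)"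
        using ra p q(2) by (intro add_left_mono ln_le_minus_one) auto
      finally have "v a * ln (r a / p) \<le> v a * (ln (q / p) + (r' a / q - 1))"
        using va by (intro mult_left_mono) auto
      then show ?thesis by (simp add: algebra_simps)
    qed simp
  qed
  also have "\<dots> = ln (q / p)"
    using v ir' p q by (simp flip: q(1))
  finally show ?thesis .
next
  case False
  \<comment> \<open>The Bochner integral defaults to 0 here, and \<open>p \<le> q\<close> makes the
    right-hand side nonnegative.\<close>
  then show ?thesis using p q(2) by (simp add: not_integrable_integral_eq)
qed

text \<open>No induction: the last update divides by its own total weight. Were that total 0,
  division by zero would make the posterior, and so the mixture, vanish.\<close>

lemma posterior_integral_eq_1:
  assumes w: "prior_density R w\<^sub>0" and pos: "mixture R w\<^sub>0 s x > 0"
  shows "(\<integral>\<rho>. posterior R w\<^sub>0 s \<rho> \<partial>R) = 1"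
proof (cases s rule: rev_cases)
  case Nil
  then show ?thesis using w by (simp add: prior_density_def)
next
  case (snoc t y)
  let ?A = "average R (posterior R w\<^sub>0 t) t y"
  have "?A \<noteq> 0"
    using pos unfolding snoc by (auto simp: mixture_def average_def update_def)
  moreover have "(\<integral>\<rho>. posterior R w\<^sub>0 t \<rho> * pmf (\<rho> t) y \<partial>R) = ?A" by (simp add: average_def)
  ultimately show ?thesis by (simp add: snoc update_def)
qed

lemma pseudo_count_bounds:
  assumes p: "0 < \<xi> s x" and q: "\<xi> s x \<le> recoding \<xi> s x" "recoding \<xi> s x \<le> 1"
    and c: "consistent \<xi> s x"
  shows "ereal (prediction_gain \<xi> s x) \<le> inverse (pseudo_count \<xi> s x)"
    and "ereal (prediction_gain \<xi> s x) \<le> inverse (ereal_sqrt (pseudo_count \<xi> s x))"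
proof -
  define p q where "p = \<xi> s x" and "q = recoding \<xi> s x"
  have "ereal (prediction_gain \<xi> s x) \<le> inverse (pseudo_count \<xi> s x) \<and>
    ereal (prediction_gain \<xi> s x) \<le> inverse (ereal_sqrt (pseudo_count \<xi> s x))"
  proof (cases "q = p")
    case True
    then show ?thesis
      by (simp add: p_def q_def prediction_gain_def pseudo_count_def ereal_sqrt_def
          flip: infinity_ereal_def)
  next
    case False
    \<comment> \<open>Consistency excludes \<open>q = 1\<close>, where the pseudo-count would be
      0.\<close>
    then have pq: "0 < p" "p < q" "q < 1"
      using assms by (auto simp: p_def q_def consistent_def)
    define N t where "N = p * (1 - q) / (q - p)" and "t = q / p - 1"
    have "0 < N" using pq by (simp add: N_def)
    have "0 \<le> t" using pq by (simp add: t_def)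
    have PG: "prediction_gain \<xi> s x = ln (1 + t)"
      using pq by (simp add: prediction_gain_def t_def ln_div flip: p_def q_def)
    have count: "pseudo_count \<xi> s x = ereal N"
      using False by (simp add: pseudo_count_def N_def flip: p_def q_def)
    have "t * (1 - q) \<le> t" using \<open>0 \<le> t\<close> pq by (intro mult_left_le) auto
    then have "t \<le> t / (1 - q)" using pq by (simp add: pos_le_divide_eq)
    also have "\<dots> = inverse N" using pq by (simp add: N_def t_def field_simps)
    finally have "t \<le> inverse N" .
    \<comment> \<open>The second bound passes through
      \<open>sqrt t \<le> sqrt (inverse N)\<close>.\<close>
    then have "ln (1 + t) \<le> inverse N" "ln (1 + t) \<le> inverse (sqrt N)"
      using ln_add_one_self_le_self[OF \<open>0 \<le> t\<close>] ln_one_plus_le_sqrt[OF \<open>0 \<le> t\<close>]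
        real_sqrt_le_mono[of t "inverse N"]
      by (auto simp: real_sqrt_inverse)
    then show ?thesis using \<open>0 < N\<close> by (simp add: PG count ereal_sqrt_def)
  qed
  then show "ereal (prediction_gain \<xi> s x) \<le> inverse (pseudo_count \<xi> s x)"
    and "ereal (prediction_gain \<xi> s x) \<le> inverse (ereal_sqrt (pseudo_count \<xi> s x))"
    by auto
qed

theorem theorem1:
  fixes M :: "('x::countable) model set"
    and R :: "'x model measure"
    and w\<^sub>0 :: "'x model \<Rightarrow> real"
    and s :: "'x list"
    and x :: 'x
  assumes "space R = M"
    and "\<And>t y. (\<lambda>\<rho>. pmf (\<rho> t) y) \<in> borel_measurable R"
    and "prior_density R w\<^sub>0"
    and "\<And>\<rho>. \<rho> \<in> M \<Longrightarrow> learning_positive \<rho>"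
    and "mixture R w\<^sub>0 s x > 0"
    and "consistent (mixture R w\<^sub>0) s x"
  shows "information_gain R w\<^sub>0 s x \<le> prediction_gain (mixture R w\<^sub>0) s x \<and>
    ereal (prediction_gain (mixture R w\<^sub>0) s x) \<le> inverse (pseudo_count (mixture R w\<^sub>0) s x) \<and>
    ereal (prediction_gain (mixture R w\<^sub>0) s x) \<le> inverse (ereal_sqrt (pseudo_count (mixture R w\<^sub>0) s x))"
proof -
  let ?w = "posterior R w\<^sub>0 s" and ?v = "posterior R w\<^sub>0 (s @ [x])"
  let ?r = "\<lambda>\<rho>. pmf (\<rho> s) x" and ?r' = "\<lambda>\<rho>. pmf (\<rho> (s @ [x])) x"
  define p q where "p = mixture R w\<^sub>0 s x" and "q = recoding (mixture R w\<^sub>0) s x"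
  have p: "p = (\<integral>\<rho>. ?w \<rho> * ?r \<rho> \<partial>R)" "0 < p"
    using assms(5) by (auto simp: p_def mixture_def average_def)
  have v: "?v \<rho> = ?w \<rho> * ?r \<rho> / p" for \<rho>
    by (simp add: update_def p_def mixture_def)
  have q: "q = (\<integral>\<rho>. ?v \<rho> * ?r' \<rho> \<partial>R)"
    by (simp add: q_def recoding_def mixture_def average_def del: posterior_snoc)
  have W: "integrable R ?w" "\<And>\<rho>. \<rho> \<in> space R \<Longrightarrow> 0 \<le> ?w \<rho>"
    and V: "integrable R ?v" "\<And>\<rho>. \<rho> \<in> space R \<Longrightarrow> 0 \<le> ?v \<rho>"
    using posterior_props[OF assms(3,2), of s] posterior_props[OF assms(3,2), of "s @ [x]"] by auto
  have W1: "(\<integral>\<rho>. ?w \<rho> \<partial>R) = 1"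
    using assms(3,5) by (rule posterior_integral_eq_1)
  have V1: "(\<integral>\<rho>. ?v \<rho> \<partial>R) = 1"
    using p by (simp add: v del: posterior_snoc)
  have r: "0 \<le> ?r \<rho> \<and> ?r \<rho> \<le> ?r' \<rho> \<and> ?r' \<rho> \<le> 1" if "\<rho> \<in> space R" for \<rho>
    using assms(1,4) that by (auto simp: learning_positive_def pmf_le_1)
  have "p \<le> q"
    unfolding q v by (rule recoding_average_ge[OF W W1 assms(2)[of s x] assms(2)[of "s @ [x]" x] r p])
  \<comment> \<open>The mixture is not a \<open>pmf\<close> by type, so \<open>q \<le> 1\<close> is
    derived from its being an average of probabilities.\<close>
  have "q \<le> (\<integral>\<rho>. ?v \<rho> \<partial>R)"
    unfolding q using V assms(2)
    by (intro integral_mono integrable_mult_bounded)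
      (auto simp: pmf_le_1 mult_left_le simp del: posterior_snoc)
  then have "q \<le> 1" by (simp only: V1)
  have "information_gain R w\<^sub>0 s x = (\<integral>\<rho>. ?v \<rho> * ln (?r \<rho> / p) \<partial>R)"
    unfolding information_gain_eq[OF assms(3,2)]
    \<comment> \<open>The old weight cancels inside \<open>ln\<close> where it is nonzero; where it
      is 0, so is the new weight in front.\<close>
    by (intro Bochner_Integration.integral_cong refl) (auto simp: v simp del: posterior_snoc)
  also have "\<dots> \<le> ln (q / p)"
  proof (rule relative_entropy_le[OF V V1 assms(2)[of "s @ [x]" x] _ _ p(2) q \<open>p \<le> q\<close>])
    show "0 < ?r \<rho>" if "0 < ?v \<rho>" for \<rho>
      using that by (cases "?r \<rho> = 0") (auto simp: v less_le simp del: posterior_snoc)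
  qed (use r in auto)
  also have "\<dots> = prediction_gain (mixture R w\<^sub>0) s x"
    using p(2) \<open>p \<le> q\<close> by (simp add: prediction_gain_def ln_div flip: p_def q_def)
  finally show ?thesis
    using pseudo_count_bounds[of "mixture R w\<^sub>0" s x] assms(5,6) \<open>p \<le> q\<close> \<open>q \<le> 1\<close>
    by (auto simp: p_def q_def)
qed

end
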